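(* Let $1<p<\infty$ and let $(\Omega,\mu)$ be any measure space. Then the space $L^p=L^p(\Omega,\mu)$ of (equivalence classes of) complex-valued $p$-integrable measurable functions, with the norm $\|u\|_p=\left(\int_\Omega |u|^p\,d\mu\right)^{1/p}$, is uniformly convex.
   Context: A normed space $X$ is called uniformly convex if for each $\epsilon>0$ there is some $\delta>0$ such that $x,y\in X$, $\|x\|\le 1$, $\|y\|\le 1$ and $\|x+y\|>2-\delta$ imply $\|x-y\|<\epsilon$. *)

theory Defs
  imports "HOL-Analysis.Analysis" "HOL-Algebra.Module" "HOL-Algebra.Algebraic_Closure_Type"
begin

section \<open>Normed spaces with an explicit carrier\<close>

text \<open>
  The space \<open>L\<^sup>p(\<mu>)\<close> depends on the measure, which is a term, so it cannot be an instance of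
  the type class \<open>real_normed_vector\<close>. Vector spaces are therefore taken in the sense of HOL-Algebra,
  as modules over a field, with the scalar field given by a type of class \<open>real_normed_field\<close>
  (in particular the reals or the complex numbers). The fields \<open>mult\<close> and \<open>one\<close> that the record of
  modules inherits from rings play no role.
\<close>

record ('k, 'v) normed_module = "('k, 'v) module" +
  vnorm :: "'v \<Rightarrow> real"

locale normed_space =
  Module.module "ring_of_type_algebra :: 'k::real_normed_field ring" V
  for V :: "('k::real_normed_field, 'v, 'm) normed_module_scheme" (structure) +
  assumes vnorm_eq_0_iff: "x \<in> carrier V \<Longrightarrow> vnorm V x = 0 \<longleftrightarrow> x = \<zero>"
    and vnorm_triangle: "x \<in> carrier V \<Longrightarrow> y \<in> carrier V \<Longrightarrow> vnorm V (x \<oplus> y) \<le> vnorm V x + vnorm V y"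
    and vnorm_smult: "x \<in> carrier V \<Longrightarrow> vnorm V (c \<odot> x) = norm c * vnorm V x"

definition uniformly_convex :: "('k::real_normed_field, 'v, 'm) normed_module_scheme \<Rightarrow> bool" where
  "uniformly_convex V \<longleftrightarrow> normed_space V \<and>
     (\<forall>\<epsilon>>0. \<exists>\<delta>>0. \<forall>x\<in>carrier V. \<forall>y\<in>carrier V.
        vnorm V x \<le> 1 \<longrightarrow> vnorm V y \<le> 1 \<longrightarrow> vnorm V (x \<oplus>\<^bsub>V\<^esub> y) > 2 - \<delta> \<longrightarrow>
        vnorm V (x \<ominus>\<^bsub>V\<^esub> y) < \<epsilon>)"


section \<open>The space of p-integrable functions modulo equality almost everywhere\<close>

definition Lp_fun :: "real \<Rightarrow> 'a measure \<Rightarrow> ('a \<Rightarrow> complex) set" where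
  "Lp_fun p M = {f \<in> borel_measurable M. integrable M (\<lambda>x. norm (f x) powr p)}"

definition Lp_rel :: "real \<Rightarrow> 'a measure \<Rightarrow> (('a \<Rightarrow> complex) \<times> ('a \<Rightarrow> complex)) set" where
  "Lp_rel p M = {(f, g). f \<in> Lp_fun p M \<and> g \<in> Lp_fun p M \<and> (AE x in M. f x = g x)}"

abbreviation Lp_class :: "real \<Rightarrow> 'a measure \<Rightarrow> ('a \<Rightarrow> complex) \<Rightarrow> ('a \<Rightarrow> complex) set" where
  "Lp_class p M f \<equiv> Lp_rel p M `` {f}"

definition Lp_fun_norm :: "real \<Rightarrow> 'a measure \<Rightarrow> ('a \<Rightarrow> complex) \<Rightarrow> real" where
  "Lp_fun_norm p M f = (\<integral>x. norm (f x) powr p \<partial>M) powr (1 / p)"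

text \<open>
  The operations on classes are induced by the pointwise ones on representatives; the lemmas
  at the end of this theory show that the choice of representatives is immaterial.
\<close>

definition Lp_space :: "real \<Rightarrow> 'a measure \<Rightarrow> (complex, ('a \<Rightarrow> complex) set) normed_module" where
  "Lp_space p M = \<lparr>
     carrier = Lp_fun p M // Lp_rel p M,
     monoid.mult = undefined,
     one = undefined,
     ring.zero = Lp_class p M (\<lambda>_. 0),
     add = (\<lambda>A B. \<Union>f\<in>A. \<Union>g\<in>B. Lp_class p M (\<lambda>x. f x + g x)),
     smult = (\<lambda>c A. \<Union>f\<in>A. Lp_class p M (\<lambda>x. c * f x)),
     vnorm = (\<lambda>A. the_elem (Lp_fun_norm p M ` A)) \<rparr>"

lemma equiv_Lp_rel: "equiv (Lp_fun p M) (Lp_rel p M)"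
proof (rule equivI)
  show "refl_on (Lp_fun p M) (Lp_rel p M)" by (auto simp: refl_on_def Lp_rel_def)
  show "Lp_rel p M \<subseteq> Lp_fun p M \<times> Lp_fun p M" by (auto simp: Lp_rel_def)
  show "sym (Lp_rel p M)" by (auto simp: sym_def Lp_rel_def elim: eventually_mono)
  show "trans (Lp_rel p M)"
  proof (rule transI)
    fix f g h assume fg: "(f, g) \<in> Lp_rel p M" and gh: "(g, h) \<in> Lp_rel p M"
    then have "AE x in M. f x = g x" "AE x in M. g x = h x" by (auto simp: Lp_rel_def)
    then have "AE x in M. f x = h x" by eventually_elim simp
    with fg gh show "(f, h) \<in> Lp_rel p M" by (auto simp: Lp_rel_def)
  qed
qed

lemma Lp_fun_add:
  assumes p: "0 < p" and f: "f \<in> Lp_fun p M" and g: "g \<in> Lp_fun p M"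
  shows "(\<lambda>x. f x + g x) \<in> Lp_fun p M"
proof -
  have [measurable]: "f \<in> borel_measurable M" "g \<in> borel_measurable M"
    using f g by (auto simp: Lp_fun_def)
  have "integrable M (\<lambda>x. norm (f x + g x) powr p)"
  proof (rule Bochner_Integration.integrable_bound)
    show "integrable M (\<lambda>x. 2 powr p * (norm (f x) powr p + norm (g x) powr p))"
      using f g by (auto simp: Lp_fun_def)
    have "norm (f x + g x) powr p \<le> 2 powr p * (norm (f x) powr p + norm (g x) powr p)" for x
    proof -
      have "norm (f x + g x) \<le> 2 * max (norm (f x)) (norm (g x))"
        using norm_triangle_ineq[of "f x" "g x"] by linarith
      then have "norm (f x + g x) powr p \<le> (2 * max (norm (f x)) (norm (g x))) powr p"
        using p by (intro powr_mono2) auto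
      also have "\<dots> = 2 powr p * max (norm (f x)) (norm (g x)) powr p"
        by (simp add: powr_mult le_max_iff_disj)
      also have "\<dots> \<le> 2 powr p * (norm (f x) powr p + norm (g x) powr p)"
        by (intro mult_left_mono) (auto simp: max_def)
      finally show ?thesis .
    qed
    then show "AE x in M. norm (norm (f x + g x) powr p)
        \<le> norm (2 powr p * (norm (f x) powr p + norm (g x) powr p))"
      by (intro AE_I2) simp
  qed measurable
  then show ?thesis by (simp add: Lp_fun_def)
qed

lemma Lp_fun_mult:
  assumes "f \<in> Lp_fun p M"
  shows "(\<lambda>x. c * f x) \<in> Lp_fun p M"
  using assms by (auto simp: Lp_fun_def norm_mult powr_mult)

lemma Lp_space_add:
  assumes p: "0 < p" and f: "f \<in> Lp_fun p M" and g: "g \<in> Lp_fun p M"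
  shows "Lp_class p M f \<oplus>\<^bsub>Lp_space p M\<^esub> Lp_class p M g = Lp_class p M (\<lambda>x. f x + g x)"
proof -
  have "congruent2 (Lp_rel p M) (Lp_rel p M) (\<lambda>f g. Lp_class p M (\<lambda>x. f x + g x))"
  proof (rule congruent2I')
    fix f f' g g' assume ff: "(f, f') \<in> Lp_rel p M" and gg: "(g, g') \<in> Lp_rel p M"
    then have "AE x in M. f x = f' x" "AE x in M. g x = g' x" by (auto simp: Lp_rel_def)
    then have "AE x in M. f x + g x = f' x + g' x" by eventually_elim simp
    with ff gg p have "((\<lambda>x. f x + g x), (\<lambda>x. f' x + g' x)) \<in> Lp_rel p M"
      by (auto simp: Lp_rel_def Lp_fun_add)
    then show "Lp_class p M (\<lambda>x. f x + g x) = Lp_class p M (\<lambda>x. f' x + g' x)"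
      by (rule equiv_class_eq[OF equiv_Lp_rel])
  qed
  from UN_equiv_class2[OF equiv_Lp_rel equiv_Lp_rel this f g] show ?thesis
    by (simp add: Lp_space_def)
qed

lemma Lp_space_smult:
  assumes f: "f \<in> Lp_fun p M"
  shows "c \<odot>\<^bsub>Lp_space p M\<^esub> Lp_class p M f = Lp_class p M (\<lambda>x. c * f x)"
proof -
  have "congruent (Lp_rel p M) (\<lambda>f. Lp_class p M (\<lambda>x. c * f x))"
  proof (rule congruentI)
    fix f g assume fg: "(f, g) \<in> Lp_rel p M"
    then have "((\<lambda>x. c * f x), (\<lambda>x. c * g x)) \<in> Lp_rel p M"
      by (auto simp: Lp_rel_def Lp_fun_mult)
    then show "Lp_class p M (\<lambda>x. c * f x) = Lp_class p M (\<lambda>x. c * g x)"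
      by (rule equiv_class_eq[OF equiv_Lp_rel])
  qed
  from UN_equiv_class[OF equiv_Lp_rel this f] show ?thesis
    by (simp add: Lp_space_def)
qed

lemma Lp_space_vnorm:
  assumes f: "f \<in> Lp_fun p M"
  shows "vnorm (Lp_space p M) (Lp_class p M f) = (\<integral>x. norm (f x) powr p \<partial>M) powr (1 / p)"
proof -
  have "Lp_fun_norm p M g = Lp_fun_norm p M f" if "(f, g) \<in> Lp_rel p M" for g
  proof -
    have [measurable]: "f \<in> borel_measurable M" "g \<in> borel_measurable M"
      and "AE x in M. f x = g x"
      using that by (auto simp: Lp_rel_def Lp_fun_def)
    from this(3) have "AE x in M. norm (g x) powr p = norm (f x) powr p"
      by eventually_elim simp
    then have "(\<integral>x. norm (g x) powr p \<partial>M) = (\<integral>x. norm (f x) powr p \<partial>M)"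
      by (intro integral_cong_AE) measurable
    then show ?thesis by (simp add: Lp_fun_norm_def)
  qed
  moreover have "f \<in> Lp_class p M f" using f by (auto simp: Lp_rel_def)
  ultimately have "Lp_fun_norm p M ` Lp_class p M f = {Lp_fun_norm p M f}"
    by blast
  then show ?thesis by (simp add: Lp_space_def Lp_fun_norm_def)
qed

end

theory Submission
  imports Defs
begin

text \<open>
  Strict convexity of \<open>|\<cdot>|\<^sup>p\<close> on the plane, compactness of the set where \<open>|a|\<^sup>p + |b|\<^sup>p = 1\<close> and
  \<open>|a - b|\<^sup>p \<ge> \<eta>\<close>, and homogeneity give for each \<open>\<eta> > 0\<close> a constant \<open>K\<close> with
  \<open>|a - b|\<^sup>p \<le> \<eta> (|a|\<^sup>p + |b|\<^sup>p) + K ((|a|\<^sup>p + |b|\<^sup>p) / 2 - |(a + b) / 2|\<^sup>p)\<close> for all \<open>a\<close> and \<open>b\<close>.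
  Integrated over \<open>a = f x\<close> and \<open>b = g x\<close> with \<open>f\<close> and \<open>g\<close> in the unit ball, the right-hand side is at
  most \<open>2 \<eta> + K (1 - \<parallel>(f + g) / 2\<parallel>\<^sup>p)\<close>, which is small when \<open>\<parallel>f + g\<parallel>\<close> is close to \<open>2\<close>.
\<close>

section \<open>Convexity of powers of the norm\<close>

text \<open>Convexity on the positive half-line extends to 0: with one argument 0 the inequality
  reduces to \<open>s powr p \<le> s\<close> for \<open>s\<close> between 0 and 1. The endpoint
  matters in Minkowski's inequality, where \<open>f x\<close> or \<open>g x\<close> may
  vanish.\<close>

lemma powr_convex_nonneg:
  assumes "1 \<le> p"
  shows "convex_on {0..} (\<lambda>x::real. x powr p)"
proof (rule convex_onI)
  fix t x y :: real
  assume t: "0 < t" "t < 1" and xy: "x \<in> {0..}" "y \<in> {0..}"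
  have powr_le: "s powr p \<le> s" if "0 < s" "s < 1" for s :: real
    using powr_mono'[of 1 p s] that assms by simp
  consider "x = 0" | "y = 0" | "0 < x" "0 < y"
    using xy by fastforce
  then show "((1 - t) *\<^sub>R x + t *\<^sub>R y) powr p \<le> (1 - t) * x powr p + t * y powr p"
  proof cases
    case 1
    then show ?thesis
      using powr_le[of t] t xy assms by (simp add: powr_mult mult_right_mono)
  next
    case 2
    then show ?thesis
      using powr_le[of "1 - t"] t xy assms by (simp add: powr_mult mult_right_mono)
  next
    case 3
    then show ?thesis
      using convex_onD[OF powr_convex[OF assms], of t x y] t by simp
  qed
qed simp

text \<open>The derivative \<open>p * z powr (p - 1)\<close> is strictly increasing, so by the mean
  value theorem the increment over the right half of the interval exceeds the increment over the
  left half.\<close>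

lemma powr_midpoint_less:
  fixes u v p :: real
  assumes p: "1 < p" and u: "0 \<le> u" and uv: "u < v"
  shows "((u + v) / 2) powr p < (u powr p + v powr p) / 2"
proof -
  have mean_value: "\<exists>z. a < z \<and> z < b \<and> b powr p - a powr p = (b - a) * (p * z powr (p - 1))"
    if "0 \<le> a" "a < b" for a b
  proof -
    \<comment> \<open>Differentiability is claimed only to the right of \<open>a\<close>, and
      continuity up to \<open>a\<close>, so that \<open>a = 0\<close> is covered.\<close>
    have deriv: "((\<lambda>x. x powr p) has_real_derivative p * x powr (p - 1)) (at x)" if "a < x" for x
      using that \<open>0 \<le> a\<close> by (intro has_real_derivative_powr) auto
    have "continuous_on {a..b} (\<lambda>x. x powr p)"
      using that p by (intro continuous_on_powr') auto
    moreover have "(\<lambda>x. x powr p) differentiable at x" if "a < x" for x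
      using deriv[OF that] real_differentiable_def by blast
    ultimately obtain l z where z: "a < z" "z < b" "DERIV (\<lambda>x. x powr p) z :> l"
      "b powr p - a powr p = (b - a) * l"
      using MVT[of a b "\<lambda>x. x powr p"] \<open>a < b\<close> by blast
    with DERIV_unique[OF z(3) deriv[OF z(1)]] show ?thesis by blast
  qed
  define m where "m = (u + v) / 2"
  obtain y where y: "u < y" "y < m" "m powr p - u powr p = (m - u) * (p * y powr (p - 1))"
    using mean_value[of u m] u uv by (auto simp: m_def)
  obtain z where z: "m < z" "z < v" "v powr p - m powr p = (v - m) * (p * z powr (p - 1))"
    using mean_value[of m v] u uv by (auto simp: m_def)
  have "y powr (p - 1) < z powr (p - 1)"
    using y z u p by (intro powr_less_mono2) auto
  then have "(m - u) * (p * y powr (p - 1)) < (v - m) * (p * z powr (p - 1))"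
    using uv p unfolding m_def by (intro mult_le_less_imp_less) auto
  then show ?thesis using y(3) z(3) by (simp add: m_def)
qed

section \<open>Midpoint inequalities for powers of a norm\<close>

text \<open>If the norms differ, strictness comes from the scalar inequality. If they agree, it
  comes from the triangle inequality: in an inner product space equality there makes the vectors
  positively parallel, hence equal.\<close>

lemma norm_powr_midpoint_less:
  fixes a b :: "'a::real_inner"
  assumes p: "1 < p" and ab: "a \<noteq> b"
  shows "(norm (a + b) / 2) powr p < (norm a powr p + norm b powr p) / 2"
proof (cases "norm a = norm b")
  case True
  have "norm (a + b) \<noteq> norm a + norm b"
  proof
    assume "norm (a + b) = norm a + norm b"
    then have "norm b *\<^sub>R b = norm b *\<^sub>R a"
      using norm_triangle_eq[of a b] True by simp
    then show False using True ab by auto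
  qed
  then have "norm (a + b) / 2 < norm a"
    using norm_triangle_ineq[of a b] True by simp
  then have "(norm (a + b) / 2) powr p < norm a powr p"
    using p by (intro powr_less_mono2) auto
  then show ?thesis using True by simp
next
  case False
  have "(norm (a + b) / 2) powr p \<le> ((norm a + norm b) / 2) powr p"
    using p norm_triangle_ineq[of a b] by (intro powr_mono2) auto
  also have "\<dots> < (norm a powr p + norm b powr p) / 2"
    using False powr_midpoint_less[OF p, of "norm a" "norm b"]
      powr_midpoint_less[OF p, of "norm b" "norm a"]
    by (cases "norm a < norm b") (auto simp: add.commute)
  finally show ?thesis .
qed

lemma norm_powr_midpoint_le:
  fixes a b :: "'a::real_inner"
  assumes p: "1 < p"
  shows "(norm (a + b) / 2) powr p \<le> (norm a powr p + norm b powr p) / 2"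
proof (cases "a = b")
  case True
  then have "norm (a + b) / 2 = norm a"
    by (simp flip: scaleR_2)
  then show ?thesis using True by simp
qed (use norm_powr_midpoint_less[OF p] in fastforce)

section \<open>The quantitative midpoint inequality\<close>

lemma norm_diff_powr_le_unit:
  fixes \<epsilon> :: real
  assumes p: "1 < p" and \<epsilon>: "0 < \<epsilon>"
  obtains K where "0 < K" "\<And>a b :: 'a::euclidean_space. norm a powr p + norm b powr p = 1 \<Longrightarrow>
    norm (a - b) powr p \<le> \<epsilon> + K * (1 / 2 - (norm (a + b) / 2) powr p)"
proof -
  define S where "S = {(a, b :: 'a). norm a powr p + norm b powr p = 1 \<and> \<epsilon> \<le> norm (a - b) powr p}"
  define gap where "gap = (\<lambda>(a, b :: 'a). 1 / 2 - (norm (a + b) / 2) powr p)"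
  have norm_le: "norm a \<le> 1 \<and> norm b \<le> 1" if "norm a powr p + norm b powr p = 1" for a b :: 'a
    using that powr_less_mono2[of p 1 "norm a"] powr_less_mono2[of p 1 "norm b"] p
      powr_ge_zero[of "norm a" p] powr_ge_zero[of "norm b" p]
    by (smt (verit) powr_one_eq_one)
  have compact_S: "compact S"
  proof -
    have "bounded S"
    proof (rule bounded_subset)
      show "S \<subseteq> cball 0 1 \<times> cball 0 1"
        using norm_le by (auto simp: S_def)
    qed (intro bounded_Times bounded_cball)
    moreover have "closed S"
      unfolding S_def case_prod_beta using p
      by (intro closed_Collect_conj closed_Collect_eq closed_Collect_le continuous_on_powr'
          continuous_intros) auto
    ultimately show ?thesis by (simp add: compact_eq_bounded_closed)
  qed
  \<comment> \<open>The continuous \<open>gap\<close> attains its minimum on the compact set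
    \<open>S\<close>, and it is positive there because pairs in \<open>S\<close> have distinct
    components.\<close>
  have gap_S: "\<exists>m>0. \<forall>c\<in>S. m \<le> gap c"
  proof (cases "S = {}")
    case False
    have "continuous_on S gap"
      unfolding gap_def case_prod_beta using p
      by (intro continuous_on_powr' continuous_intros) auto
    from continuous_attains_inf[OF compact_S False this]
    obtain c where c: "c \<in> S" "\<And>d. d \<in> S \<Longrightarrow> gap c \<le> gap d" by blast
    obtain a b where ab: "c = (a, b)" by fastforce
    then have "a \<noteq> b" using c(1) \<epsilon> p by (auto simp: S_def)
    then have "0 < gap c"
      using norm_powr_midpoint_less[OF p, of a b] c(1) ab by (simp add: gap_def S_def)
    then show ?thesis using c(2) by blast
  qed (auto intro: exI[of _ 1])
  then obtain m where m: "0 < m" "\<And>c. c \<in> S \<Longrightarrow> m \<le> gap c" by blast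
  show thesis
  proof (rule that)
    \<comment> \<open>On \<open>S\<close> the gap is at least \<open>m\<close> while the left-hand
      side is at most \<open>2 powr p\<close>, so this factor suffices. Off \<open>S\<close> the
      term \<epsilon> alone suffices, as the gap is nonnegative.\<close>
    show "0 < 2 powr p / m" using m by simp
    fix a b :: 'a assume ab: "norm a powr p + norm b powr p = 1"
    show "norm (a - b) powr p \<le> \<epsilon> + 2 powr p / m * (1 / 2 - (norm (a + b) / 2) powr p)"
    proof (cases "(a, b) \<in> S")
      case True
      have "norm (a - b) \<le> 2"
        using norm_triangle_ineq4[of a b] norm_le[OF ab] by linarith
      then have "norm (a - b) powr p \<le> 2 powr p"
        using p by (intro powr_mono2) auto
      also have "\<dots> = 2 powr p / m * m" using m by simp
      also have "\<dots> \<le> 2 powr p / m * gap (a, b)"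
        using m True by (intro mult_left_mono) auto
      finally show ?thesis using \<epsilon> by (simp add: gap_def)
    next
      case False
      then have "norm (a - b) powr p \<le> \<epsilon>" using ab by (simp add: S_def)
      moreover have "0 \<le> 2 powr p / m * (1 / 2 - (norm (a + b) / 2) powr p)"
        using norm_powr_midpoint_le[OF p, of a b] ab m by (intro mult_nonneg_nonneg) auto
      ultimately show ?thesis by linarith
    qed
  qed
qed

lemma norm_diff_powr_le:
  fixes \<epsilon> :: real
  assumes p: "1 < p" and \<epsilon>: "0 < \<epsilon>"
  obtains K where "0 < K" "\<And>a b :: 'a::euclidean_space. norm (a - b) powr p \<le>
    \<epsilon> * (norm a powr p + norm b powr p)
    + K * ((norm a powr p + norm b powr p) / 2 - (norm (a + b) / 2) powr p)"
proof -
  from norm_diff_powr_le_unit[OF p \<epsilon>, where 'a = 'a]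
  obtain K where K: "0 < K" "\<And>a b :: 'a. norm a powr p + norm b powr p = 1 \<Longrightarrow>
    norm (a - b) powr p \<le> \<epsilon> + K * (1 / 2 - (norm (a + b) / 2) powr p)"
    by blast
  show thesis
  proof (rule that[OF K(1)])
    fix a b :: 'a
    define r where "r = norm a powr p + norm b powr p"
    show "norm (a - b) powr p \<le> \<epsilon> * (norm a powr p + norm b powr p)
      + K * ((norm a powr p + norm b powr p) / 2 - (norm (a + b) / 2) powr p)"
    proof (cases "r = 0")
      case True
      then have "a = 0" "b = 0" by (auto simp: r_def add_nonneg_eq_0_iff)
      then show ?thesis by simp
    next
      case False
      then have r: "0 < r" by (simp add: r_def less_le)
      \<comment> \<open>Both sides are homogeneous of degree \<open>p\<close>; dividing the vectors
        by \<open>s\<close> divides each side by \<open>r\<close> and normalises the pair.\<close>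
      define s where "s = r powr (1 / p)"
      have s: "0 < s" "s powr p = r"
        using r p by (auto simp: s_def powr_powr)
      have norm_div: "norm (c /\<^sub>R s) powr p = norm c powr p / r" for c :: 'a
        using s by (simp add: powr_divide divide_inverse_commute[symmetric])
      have half: "(norm (c /\<^sub>R s) / 2) powr p = (norm c / 2) powr p / r" for c :: 'a
        using norm_div[of c] by (simp add: powr_divide)
      have "norm (a /\<^sub>R s) powr p + norm (b /\<^sub>R s) powr p = 1"
        using r by (simp only: norm_div) (simp add: r_def flip: add_divide_distrib)
      from K(2)[OF this] have "norm (a - b) powr p / r
          \<le> \<epsilon> + K * (1 / 2 - (norm (a + b) / 2) powr p / r)"
        by (simp only: flip: scaleR_diff_right scaleR_add_right norm_div half)
      then have "norm (a - b) powr p \<le> r * (\<epsilon> + K * (1 / 2 - (norm (a + b) / 2) powr p / r))"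
        using r by (simp only: pos_divide_le_eq mult.commute)
      also have "\<dots> = \<epsilon> * r + K * (r / 2 - (norm (a + b) / 2) powr p)"
        using r by (simp add: field_simps)
      finally show ?thesis by (simp add: r_def)
    qed
  qed
qed


section \<open>The normed space of p-integrable functions\<close>

lemma Lp_fun_measurable: "f \<in> Lp_fun p M \<Longrightarrow> f \<in> borel_measurable M"
  by (simp add: Lp_fun_def)

lemma Lp_fun_integrable: "f \<in> Lp_fun p M \<Longrightarrow> integrable M (\<lambda>x. norm (f x) powr p)"
  by (simp add: Lp_fun_def)

lemma Lp_fun_zero: "(\<lambda>_. 0) \<in> Lp_fun p M"
  by (simp add: Lp_fun_def)

lemma Lp_fun_norm_nonneg: "0 \<le> Lp_fun_norm p M f"
  by (simp add: Lp_fun_norm_def)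

lemma Lp_fun_norm_powr:
  assumes "0 < p"
  shows "Lp_fun_norm p M f powr p = (\<integral>x. norm (f x) powr p \<partial>M)"
  using assms by (simp add: Lp_fun_norm_def powr_powr)

lemma Lp_fun_norm_le_iff:
  assumes "0 < p" "0 \<le> s"
  shows "Lp_fun_norm p M f \<le> s \<longleftrightarrow> (\<integral>x. norm (f x) powr p \<partial>M) \<le> s powr p"
  unfolding Lp_fun_norm_powr[OF assms(1), symmetric]
  using assms Lp_fun_norm_nonneg[of p M f] powr_mono2[of p "Lp_fun_norm p M f" s]
    powr_less_mono2[of p s "Lp_fun_norm p M f"] by force

lemma Lp_fun_norm_cong_AE:
  assumes "f \<in> borel_measurable M" "g \<in> borel_measurable M" "AE x in M. norm (f x) = norm (g x)"
  shows "Lp_fun_norm p M f = Lp_fun_norm p M g"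
proof -
  have "(\<integral>x. norm (f x) powr p \<partial>M) = (\<integral>x. norm (g x) powr p \<partial>M)"
    using assms by (intro integral_cong_AE) (auto elim: eventually_mono)
  then show ?thesis by (simp add: Lp_fun_norm_def)
qed

lemma Lp_fun_norm_eq_0_iff:
  assumes p: "0 < p" and f: "f \<in> Lp_fun p M"
  shows "Lp_fun_norm p M f = 0 \<longleftrightarrow> (AE x in M. f x = 0)"
proof -
  have "Lp_fun_norm p M f = 0 \<longleftrightarrow> (\<integral>x. norm (f x) powr p \<partial>M) = 0"
    by (simp add: Lp_fun_norm_def)
  also have "\<dots> \<longleftrightarrow> (AE x in M. f x = 0)"
    using integral_nonneg_eq_0_iff_AE[OF Lp_fun_integrable[OF f]] by simp
  finally show ?thesis .
qed

lemma Lp_fun_norm_mult: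
  assumes "0 < p"
  shows "Lp_fun_norm p M (\<lambda>x. c * f x) = norm c * Lp_fun_norm p M f"
  using assms by (simp add: Lp_fun_norm_def norm_mult powr_mult powr_powr)

text \<open>Minkowski's inequality from convexity of the power function, applied pointwise with
  weights proportional to the two norms and then integrated. Vanishing norms are split off because
  the argument divides by them; there one function is zero almost everywhere.\<close>

lemma Lp_fun_norm_triangle:
  assumes p: "1 \<le> p" and f: "f \<in> Lp_fun p M" and g: "g \<in> Lp_fun p M"
  shows "Lp_fun_norm p M (\<lambda>x. f x + g x) \<le> Lp_fun_norm p M f + Lp_fun_norm p M g"
proof -
  have [measurable]: "f \<in> borel_measurable M" "g \<in> borel_measurable M"
    using f g by (auto simp: Lp_fun_measurable)
  define s t where "s = Lp_fun_norm p M f" and "t = Lp_fun_norm p M g"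
  consider "s = 0" | "t = 0" | "0 < s" "0 < t"
    using Lp_fun_norm_nonneg[of p M f] Lp_fun_norm_nonneg[of p M g] by (fastforce simp: s_def t_def)
  then show ?thesis
  proof cases
    case 1
    then have "AE x in M. f x = 0" using f p by (simp add: s_def Lp_fun_norm_eq_0_iff)
    then have "Lp_fun_norm p M (\<lambda>x. f x + g x) = t"
      unfolding t_def by (intro Lp_fun_norm_cong_AE) (auto elim: eventually_mono)
    then show ?thesis by (simp add: t_def Lp_fun_norm_nonneg)
  next
    case 2
    then have "AE x in M. g x = 0" using g p by (simp add: t_def Lp_fun_norm_eq_0_iff)
    then have "Lp_fun_norm p M (\<lambda>x. f x + g x) = s"
      unfolding s_def by (intro Lp_fun_norm_cong_AE) (auto elim: eventually_mono)
    then show ?thesis by (simp add: s_def Lp_fun_norm_nonneg)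
  next
    case 3
    define w where "w = t / (s + t)"
    have w: "0 \<le> w" "w \<le> 1" using 3 by (auto simp: w_def)
    have w_add: "(s + t) * (1 - w) = s" "(s + t) * w = t"
      using 3 by (auto simp: w_def right_diff_distrib)
    \<comment> \<open>\<open>f + g\<close> is \<open>s + t\<close> times a convex combination of the unit vectors \<open>f / s\<close> and \<open>g / t\<close>.\<close>
    have bound: "norm (f x + g x) powr p \<le> (s + t) powr p *
        ((1 - w) * (norm (f x) powr p / s powr p) + w * (norm (g x) powr p / t powr p))" for x
    proof -
      have "norm (f x + g x) \<le> norm (f x) + norm (g x)"
        by (rule norm_triangle_ineq)
      also have "\<dots> = (s + t) * ((1 - w) *\<^sub>R (norm (f x) / s) + w *\<^sub>R (norm (g x) / t))"
        using 3 w_add by (simp add: distrib_left mult.assoc[symmetric])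
      finally have "norm (f x + g x) powr p
          \<le> ((s + t) * ((1 - w) *\<^sub>R (norm (f x) / s) + w *\<^sub>R (norm (g x) / t))) powr p"
        using p by (intro powr_mono2) auto
      also have "\<dots> = (s + t) powr p *
          ((1 - w) *\<^sub>R (norm (f x) / s) + w *\<^sub>R (norm (g x) / t)) powr p"
        using 3 w by (intro powr_mult)
      also have "\<dots> \<le> (s + t) powr p *
          ((1 - w) * (norm (f x) / s) powr p + w * (norm (g x) / t) powr p)"
        using 3 w by (intro mult_left_mono convex_onD[OF powr_convex_nonneg[OF p]]) auto
      finally show ?thesis using 3 by (simp add: powr_divide)
    qed
    have "(\<integral>x. norm (f x + g x) powr p \<partial>M) \<le> (\<integral>x. (s + t) powr p *
        ((1 - w) * (norm (f x) powr p / s powr p) + w * (norm (g x) powr p / t powr p)) \<partial>M)"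
      using p f g by (intro integral_mono bound Lp_fun_integrable Lp_fun_add)
        (auto intro!: Bochner_Integration.integrable_add integrable_mult_right integrable_divide
          Lp_fun_integrable)
    \<comment> \<open>The integrals of the p-th powers are \<open>s powr p\<close> and
      \<open>t powr p\<close>, so both normalised integrals are 1 and the weights add up to
      1.\<close>
    also have "\<dots> = (s + t) powr p *
        ((1 - w) * (s powr p / s powr p) + w * (t powr p / t powr p))"
      using p by (simp add: s_def t_def Lp_fun_norm_powr Lp_fun_integrable[OF f] Lp_fun_integrable[OF g])
    also have "\<dots> = (s + t) powr p" using 3 by simp
    finally show ?thesis
      using p 3 by (simp add: Lp_fun_norm_le_iff flip: s_def t_def)
  qed
qed

section \<open>The quotient as a normed space\<close>

lemma carrier_Lp_space_cases:
  assumes "A \<in> carrier (Lp_space p M)"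
  obtains f where "A = Lp_class p M f" "f \<in> Lp_fun p M"
  using assms by (auto simp: Lp_space_def elim: quotientE)

lemma Lp_class_in_carrier: "f \<in> Lp_fun p M \<Longrightarrow> Lp_class p M f \<in> carrier (Lp_space p M)"
  by (simp add: Lp_space_def quotientI)

lemma Lp_space_zero: "\<zero>\<^bsub>Lp_space p M\<^esub> = Lp_class p M (\<lambda>_. 0)"
  by (simp add: Lp_space_def)

lemma Lp_class_eq_iff:
  assumes "f \<in> Lp_fun p M" "g \<in> Lp_fun p M"
  shows "Lp_class p M f = Lp_class p M g \<longleftrightarrow> (AE x in M. f x = g x)"
  using eq_equiv_class_iff[OF equiv_Lp_rel assms] assms by (simp add: Lp_rel_def)

lemma vnorm_Lp_space: "f \<in> Lp_fun p M \<Longrightarrow> vnorm (Lp_space p M) (Lp_class p M f) = Lp_fun_norm p M f"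
  by (simp add: Lp_space_vnorm Lp_fun_norm_def)

lemma abelian_group_Lp_space:
  assumes p: "0 < p"
  shows "abelian_group (Lp_space p M)"
proof (rule abelian_groupI)
  fix A assume "A \<in> carrier (Lp_space p M)"
  then obtain f where f: "A = Lp_class p M f" "f \<in> Lp_fun p M"
    by (rule carrier_Lp_space_cases)
  then have "Lp_class p M (\<lambda>x. - 1 * f x) \<oplus>\<^bsub>Lp_space p M\<^esub> A = \<zero>\<^bsub>Lp_space p M\<^esub>"
    using p Lp_fun_mult[of f p M "- 1"] by (simp add: Lp_space_add Lp_space_zero)
  then show "\<exists>B\<in>carrier (Lp_space p M). B \<oplus>\<^bsub>Lp_space p M\<^esub> A = \<zero>\<^bsub>Lp_space p M\<^esub>"
    using f Lp_class_in_carrier Lp_fun_mult by blast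
qed (auto elim!: carrier_Lp_space_cases simp: p Lp_space_zero Lp_space_add Lp_fun_add Lp_fun_zero
    Lp_class_in_carrier add_ac)

text \<open>Subtraction of classes means adding the group inverse, which is identified through
  uniqueness of inverses.\<close>

lemma Lp_space_minus:
  assumes p: "0 < p" and f: "f \<in> Lp_fun p M" and g: "g \<in> Lp_fun p M"
  shows "Lp_class p M f \<ominus>\<^bsub>Lp_space p M\<^esub> Lp_class p M g = Lp_class p M (\<lambda>x. f x - g x)"
proof -
  interpret abelian_group "Lp_space p M" by (rule abelian_group_Lp_space[OF p])
  have g': "(\<lambda>x. - g x) \<in> Lp_fun p M" using Lp_fun_mult[OF g, of "-1"] by simp
  have "\<ominus>\<^bsub>Lp_space p M\<^esub> Lp_class p M g = Lp_class p M (\<lambda>x. - g x)"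
    using p g g' by (intro minus_equality) (auto simp: Lp_space_add Lp_space_zero Lp_class_in_carrier)
  then show ?thesis using p f g' by (simp add: a_minus_def Lp_space_add)
qed

lemma normed_space_Lp_space:
  assumes p: "1 \<le> p"
  shows "normed_space (Lp_space p M)"
proof -
  have p0: "0 < p" using p by simp
  note rules = p p0 Lp_space_zero Lp_space_add Lp_space_smult Lp_fun_add Lp_fun_mult Lp_fun_zero
    Lp_class_in_carrier vnorm_Lp_space
  \<comment> \<open>The module laws use the operations of the scalar ring record; these equations
    turn them into complex arithmetic on representatives.\<close>
  have ring_ops: "add (ring_of_type_algebra :: complex ring) = (+)"
    "monoid.mult (ring_of_type_algebra :: complex ring) = (*)"
    "one (ring_of_type_algebra :: complex ring) = 1"
    by (simp_all add: ring_of_type_algebra_def)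
  show ?thesis
  proof (intro normed_space.intro normed_space_axioms.intro moduleI)
    fix A assume "A \<in> carrier (Lp_space p M)"
    then obtain f where f: "A = Lp_class p M f" "f \<in> Lp_fun p M"
      by (rule carrier_Lp_space_cases)
    then show "vnorm (Lp_space p M) A = 0 \<longleftrightarrow> A = \<zero>\<^bsub>Lp_space p M\<^esub>"
      by (simp add: rules Lp_fun_norm_eq_0_iff Lp_class_eq_iff)
  qed (auto elim!: carrier_Lp_space_cases simp: rules ring_ops abelian_group_Lp_space
      algebra_simps Lp_fun_norm_mult Lp_fun_norm_triangle cring_from_type_algebra)
qed


section \<open>Uniform convexity\<close>

text \<open>The constant \<open>K\<close> comes from the plane alone, so \<delta> can be fixed
  before the measure and the functions.\<close>

lemma Lp_fun_uniformly_convex: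
  assumes p: "1 < p" and \<epsilon>: "0 < \<epsilon>"
  obtains \<delta> where "0 < \<delta>"
    "\<And>M (f :: 'a \<Rightarrow> complex) g. f \<in> Lp_fun p M \<Longrightarrow> g \<in> Lp_fun p M \<Longrightarrow>
      Lp_fun_norm p M f \<le> 1 \<Longrightarrow> Lp_fun_norm p M g \<le> 1 \<Longrightarrow>
      2 - \<delta> < Lp_fun_norm p M (\<lambda>x. f x + g x) \<Longrightarrow> Lp_fun_norm p M (\<lambda>x. f x - g x) < \<epsilon>"
proof -
  have p0: "0 < p" using p by simp
  \<comment> \<open>The integrated estimate will be below \<open>2 * \<eta> + \<eta>\<close>, hence
    below \<open>4 * \<eta> = \<epsilon> powr p\<close>.\<close>
  define \<eta> where "\<eta> = \<epsilon> powr p / 4"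
  have \<eta>: "0 < \<eta>" using \<epsilon> by (simp add: \<eta>_def)
  obtain K where K: "0 < K" "\<And>a b :: complex. norm (a - b) powr p \<le>
      \<eta> * (norm a powr p + norm b powr p)
      + K * ((norm a powr p + norm b powr p) / 2 - (norm (a + b) / 2) powr p)"
    using norm_diff_powr_le[OF p \<eta>] by blast
  \<comment> \<open>A lower bound to be enforced on the p-th power of the norm of the midpoint:
    above it the \<open>K\<close> term stays below \<eta>. The maximum with \<open>1 / 2\<close>
    keeps \<kappa> positive, so that its p-th root is meaningful.\<close>
  define \<kappa> where "\<kappa> = max (1 / 2) (1 - \<eta> / K)"
  have \<kappa>: "0 < \<kappa>" "\<kappa> < 1"
    using \<eta> K(1) by (auto simp: \<kappa>_def less_max_iff_disj)
  have "1 - \<kappa> \<le> \<eta> / K" by (simp add: \<kappa>_def)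
  then have K\<kappa>: "K * (1 - \<kappa>) \<le> \<eta>"
    using K(1) by (simp add: pos_le_divide_eq mult.commute)
  \<comment> \<open>Chosen so that a norm of \<open>f + g\<close> above \<open>2 - \<delta>\<close>
    gives, after halving and taking p-th powers, a value above \<kappa>.\<close>
  define \<delta> where "\<delta> = 2 - 2 * \<kappa> powr (1 / p)"
  show thesis
  proof (rule that)
    have "\<kappa> powr (1 / p) < 1" using powr_less_mono2[of "1 / p" \<kappa> 1] \<kappa> p by simp
    then show "0 < \<delta>" by (simp add: \<delta>_def)
    fix M :: "'a measure" and f g :: "'a \<Rightarrow> complex"
    assume f: "f \<in> Lp_fun p M" and g: "g \<in> Lp_fun p M"
      and f1: "Lp_fun_norm p M f \<le> 1" and g1: "Lp_fun_norm p M g \<le> 1"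
      and fg: "2 - \<delta> < Lp_fun_norm p M (\<lambda>x. f x + g x)"
    \<comment> \<open>\<open>F\<close>, \<open>G\<close> and \<open>H\<close> are the p-th powers of
      the norms of \<open>f\<close>, \<open>g\<close> and their midpoint.\<close>
    define F G H where "F = (\<integral>x. norm (f x) powr p \<partial>M)" and "G = (\<integral>x. norm (g x) powr p \<partial>M)"
      and "H = (\<integral>x. norm (f x + g x) powr p \<partial>M) / 2 powr p"
    have diff: "(\<lambda>x. f x - g x) \<in> Lp_fun p M"
      using Lp_fun_add[OF p0 f Lp_fun_mult[OF g, of "-1"]] by simp
    note int = Lp_fun_integrable[OF f] Lp_fun_integrable[OF g]
      Lp_fun_integrable[OF diff] Lp_fun_integrable[OF Lp_fun_add[OF p0 f g]]
    have FG: "F \<le> 1" "G \<le> 1"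
      using f1 g1 p0 by (simp_all add: Lp_fun_norm_le_iff F_def G_def)
    have "(2 * \<kappa> powr (1 / p)) powr p < Lp_fun_norm p M (\<lambda>x. f x + g x) powr p"
      using fg p by (intro powr_less_mono2) (auto simp: \<delta>_def)
    then have "\<kappa> < H"
      using \<kappa> p0
      by (simp add: powr_mult powr_powr Lp_fun_norm_powr H_def pos_less_divide_eq mult.commute)
    then have "1 - H < 1 - \<kappa>"
      by (rule diff_strict_left_mono)
    moreover have "(F + G) / 2 - H \<le> 1 - H"
      using FG by (intro diff_right_mono) simp
    ultimately have "(F + G) / 2 - H < 1 - \<kappa>"
      by (rule le_less_trans[rotated])
    then have "K * ((F + G) / 2 - H) < K * (1 - \<kappa>)"
      using K(1) by (rule mult_strict_left_mono)
    then have gap: "K * ((F + G) / 2 - H) < \<eta>"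
      using K\<kappa> by (rule less_le_trans)
    have "(\<integral>x. norm (f x - g x) powr p \<partial>M) \<le> (\<integral>x. \<eta> * (norm (f x) powr p + norm (g x) powr p)
        + K * ((norm (f x) powr p + norm (g x) powr p) / 2 - norm (f x + g x) powr p / 2 powr p) \<partial>M)"
    proof (rule integral_mono)
      show "norm (f x - g x) powr p \<le> \<eta> * (norm (f x) powr p + norm (g x) powr p)
          + K * ((norm (f x) powr p + norm (g x) powr p) / 2 - norm (f x + g x) powr p / 2 powr p)" for x
        using K(2)[of "f x" "g x"] by (simp only: powr_divide)
    qed (intro int Bochner_Integration.integrable_add Bochner_Integration.integrable_diff
        integrable_mult_right integrable_divide)+
    also have "\<dots> = \<eta> * (F + G) + K * ((F + G) / 2 - H)"
      using int by (simp add: F_def G_def H_def)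
    also have "\<dots> < \<eta> * 2 + \<eta>"
      using FG \<eta> gap by (intro add_le_less_mono mult_left_mono) auto
    also have "\<dots> < \<epsilon> powr p" using \<epsilon> by (simp add: \<eta>_def)
    finally have "Lp_fun_norm p M (\<lambda>x. f x - g x) powr p < \<epsilon> powr p"
      using p0 by (simp add: Lp_fun_norm_powr)
    then show "Lp_fun_norm p M (\<lambda>x. f x - g x) < \<epsilon>"
      using p0 \<epsilon> powr_mono2[of p \<epsilon> "Lp_fun_norm p M (\<lambda>x. f x - g x)"] by force
  qed
qed

theorem theorem3:
  fixes p :: real and M :: "'a measure"
  assumes "1 < p"
  shows "uniformly_convex (Lp_space p M)"
  unfolding uniformly_convex_def
proof (intro conjI allI impI)
  show "normed_space (Lp_space p M)" using assms by (intro normed_space_Lp_space) simp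
  have p: "0 < p" using assms by simp
  fix \<epsilon> :: real assume "0 < \<epsilon>"
  from Lp_fun_uniformly_convex[OF assms this, where 'a = 'a] obtain \<delta> where \<delta>: "0 < \<delta>"
    "\<And>f g. f \<in> Lp_fun p M \<Longrightarrow> g \<in> Lp_fun p M \<Longrightarrow>
      Lp_fun_norm p M f \<le> 1 \<Longrightarrow> Lp_fun_norm p M g \<le> 1 \<Longrightarrow>
      2 - \<delta> < Lp_fun_norm p M (\<lambda>x. f x + g x) \<Longrightarrow> Lp_fun_norm p M (\<lambda>x. f x - g x) < \<epsilon>"
    by metis
  \<comment> \<open>Representatives of the two classes reduce the claim to the statement about
    functions.\<close>
  have "vnorm (Lp_space p M) (A \<ominus>\<^bsub>Lp_space p M\<^esub> B) < \<epsilon>"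
    if carrier: "A \<in> carrier (Lp_space p M)" "B \<in> carrier (Lp_space p M)"
      and norms: "vnorm (Lp_space p M) A \<le> 1" "vnorm (Lp_space p M) B \<le> 1"
        "2 - \<delta> < vnorm (Lp_space p M) (A \<oplus>\<^bsub>Lp_space p M\<^esub> B)" for A B
  proof -
    obtain f where f: "A = Lp_class p M f" "f \<in> Lp_fun p M"
      using carrier(1) by (rule carrier_Lp_space_cases)
    obtain g where g: "B = Lp_class p M g" "g \<in> Lp_fun p M"
      using carrier(2) by (rule carrier_Lp_space_cases)
    have "(\<lambda>x. f x - g x) \<in> Lp_fun p M"
      using Lp_fun_add[OF p f(2) Lp_fun_mult[OF g(2), of "-1"]] by simp
    then show ?thesis
      using \<delta>(2)[of f g] f g norms p
      by (simp add: Lp_space_add Lp_space_minus vnorm_Lp_space Lp_fun_add)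
  qed
  with \<delta>(1) show "\<exists>\<delta>>0. \<forall>x\<in>carrier (Lp_space p M). \<forall>y\<in>carrier (Lp_space p M).
      vnorm (Lp_space p M) x \<le> 1 \<longrightarrow> vnorm (Lp_space p M) y \<le> 1 \<longrightarrow>
      2 - \<delta> < vnorm (Lp_space p M) (x \<oplus>\<^bsub>Lp_space p M\<^esub> y) \<longrightarrow>
      vnorm (Lp_space p M) (x \<ominus>\<^bsub>Lp_space p M\<^esub> y) < \<epsilon>"
    by blast
qed

end
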